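(* Let $p,r>1$ and $0<\mu<N_\gamma$ with $\frac1p+\frac{\mu}{N_\gamma}+\frac1r=2$. Let $f\in L^p(\mathbb{R}^N)$ and $h\in L^r(\mathbb{R}^N)$. Then there exists a positive constant $C(p,N_\gamma,\mu,r)$, independent of $f$ and $h$, such that $$\int_{\mathbb{R}^N}\int_{\mathbb{R}^N}\frac{f(z)h(w)}{d(z-w)^\mu}\,dz\,dw\leq C(p,N_\gamma,\mu,r)\,\|f\|_p\,\|h\|_r .$$
   Context: Write $z=(x,y)\in\mathbb{R}^m\times\mathbb{R}^n=\mathbb{R}^N$, where $m,n$ are non-negative integers with $m+n=N\geq 3$, and let $\gamma\geq 0$. The homogeneous norm is $d(z)=(|x|^{2(\gamma+1)}+|y|^2)^{\frac{1}{2(\gamma+1)}}$ and the homogeneous dimension is $N_\gamma=m+(1+\gamma)n$. $\|\cdot\|_p$ is the norm of $L^p(\mathbb{R}^N)$ with respect to Lebesgue measure. *)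

theory Defs
  imports "HOL-Analysis.Analysis"
begin

text \<open>
  Points of \<open>\<real>\<^sup>m \<times> \<real>\<^sup>n = \<real>\<^sup>N\<close> are extensional functions on \<open>{..<m + n}\<close>: coordinates below \<open>m\<close>
  form \<open>x\<close>, the others form \<open>y\<close>. The types \<open>real ^ 'm\<close> and \<open>real ^ 'n\<close> would exclude \<open>m = 0\<close> and
  \<open>n = 0\<close>, and would not allow quantification over the dimensions inside a formula.
\<close>

text \<open>The product measure alone is only defined on Borel sets; its completion is Lebesgue measure.\<close>

definition lebesgue_Rn :: "nat \<Rightarrow> (nat \<Rightarrow> real) measure" where
  "lebesgue_Rn N = completion (\<Pi>\<^sub>M i\<in>{..<N}. lborel)"

text \<open>Membership and norm are stated for representatives, not for almost-everywhere classes.\<close>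

definition Lp_space :: "real \<Rightarrow> 'a measure \<Rightarrow> ('a \<Rightarrow> real) set" where
  "Lp_space p M = {f \<in> borel_measurable M. integrable M (\<lambda>x. \<bar>f x\<bar> powr p)}"

definition Lp_norm :: "real \<Rightarrow> 'a measure \<Rightarrow> ('a \<Rightarrow> real) \<Rightarrow> real" where
  "Lp_norm p M f = (LINT x|M. \<bar>f x\<bar> powr p) powr (1 / p)"

definition hom_dim :: "nat \<Rightarrow> nat \<Rightarrow> real \<Rightarrow> real" where
  "hom_dim m n \<gamma> = real m + (1 + \<gamma>) * real n"

text \<open>
  Only coordinates below \<open>m + n\<close> are read, so the pointwise difference \<open>z - w\<close> of two points can be
  used as an argument although it is not extensional.
\<close>

definition hom_norm :: "nat \<Rightarrow> nat \<Rightarrow> real \<Rightarrow> (nat \<Rightarrow> real) \<Rightarrow> real" where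
  "hom_norm m n \<gamma> z =
     (L2_set z {..<m} powr (2 * (\<gamma> + 1)) + (L2_set z {m..<m + n})\<^sup>2) powr (1 / (2 * (\<gamma> + 1)))"

text \<open>At \<open>z = w\<close> the value is \<open>0\<close>, by division by zero; the diagonal is a null set.\<close>

definition HLS_integrand ::
  "nat \<Rightarrow> nat \<Rightarrow> real \<Rightarrow> real \<Rightarrow> ((nat \<Rightarrow> real) \<Rightarrow> real) \<Rightarrow> ((nat \<Rightarrow> real) \<Rightarrow> real) \<Rightarrow>
    (nat \<Rightarrow> real) \<Rightarrow> (nat \<Rightarrow> real) \<Rightarrow> real" where
  "HLS_integrand m n \<gamma> \<mu> f h z w = f z * h w / hom_norm m n \<gamma> (z - w) powr \<mu>"

end

theory Submission
  imports Defs
begin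

text \<open>
  The Hardy--Littlewood--Sobolev inequality reflects how fast the balls of \<open>d\<close> grow.
  Let \<open>Q\<close> be the homogeneous dimension and \<open>K z w = d(z - w) powr (- Q)\<close>. A ball of radius \<open>\<rho>\<close> lies
  in a box with sides \<open>2 \<rho>\<close> (\<open>m\<close> times) and \<open>2 \<rho> powr (1 + \<gamma>)\<close> (\<open>n\<close> times), whose volume is
  \<open>2 ^ (m + n) * \<rho> powr Q\<close>. Hence \<open>K\<close> is of weak type \<open>L\<^sup>1\<close> in either variable:
  \<open>\<bar>{z. t \<le> K z w}\<bar> \<le> A / t\<close> (lemma \<open>hom_norm_kernel_weak_L1\<close>). Since \<open>m + n \<le> Q\<close>, one may take
  \<open>A = 2 powr Q\<close>, and so the final constant depends on \<open>m\<close>, \<open>n\<close>, \<open>\<gamma>\<close> through \<open>Q\<close> alone.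

  Put \<open>F = \<bar>f\<bar> powr p\<close> and \<open>H = \<bar>h\<bar> powr r\<close>, scaled so that both have integral \<open>1\<close>, and \<open>a = 1 / p\<close>,
  \<open>b = 1 / r\<close>, \<open>c = \<mu> / Q\<close>. What has to be bounded is
  \<open>\<integral>\<integral> F(z) powr a * H(w) powr b * K(z,w) powr c\<close>, where \<open>a\<close>, \<open>b\<close>, \<open>c\<close> lie in \<open>(0, 1)\<close> and have sum \<open>2\<close>.
  By symmetry it suffices to treat the part where \<open>F(z) \<le> H(w)\<close>. Fix \<open>w\<close> and put \<open>s = H(w)\<close>. Where
  \<open>F \<le> s\<close>, comparing \<open>K\<close> with \<open>F\<close> and with \<open>s\<close> gives
  \<open>F powr a * K powr c \<le> s powr (a + c - 1) * F\<close> if \<open>K \<le> F\<close>,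
  \<open>F powr a * K powr c \<le> K powr (a + c)\<close> if \<open>F \<le> K \<le> s\<close>, and
  \<open>F powr a * K powr c \<le> s powr a * K powr c\<close> if \<open>s \<le> K\<close>.
  Because \<open>c < 1 < a + c\<close>, the weak type bound controls both integrals of powers of \<open>K\<close> by geometric
  series over dyadic levels, and each of the three contributions is at most a constant times
  \<open>s powr (a + c - 1) = H(w) powr (1 - b)\<close> (lemma \<open>weak_L1_product_slice\<close>). Multiplying by
  \<open>H(w) powr b\<close> leaves \<open>H(w)\<close>, which integrates to \<open>1\<close>. The argument uses of \<open>K\<close>
  only its weak type in each variable, and is carried out on a pair of sigma-finite measure spaces
  (lemma \<open>weak_kernel_HLS\<close>).
\<close>

section \<open>Powers of functions of weak type \<open>L\<^sup>1\<close>\<close>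

text \<open>
  The two integrals of powers of \<open>K\<close> below are both estimated by majorising the integrand by a sum
  of multiples \<open>u k\<close> of indicators of superlevel sets \<open>{t k \<le> K}\<close>; the weak type bound makes the
  \<open>k\<close>-th term at most \<open>u k * (A / t k)\<close>, which is geometric when the levels are dyadic.
\<close>

lemma nn_integral_le_geometric:
  fixes K :: "'a \<Rightarrow> real" and u t :: "nat \<Rightarrow> real" and g :: "'a \<Rightarrow> ennreal"
  assumes [measurable]: "K \<in> borel_measurable M"
    and weak: "\<And>t. 0 < t \<Longrightarrow> emeasure M {z \<in> space M. t \<le> K z} \<le> ennreal (A / t)"
    and t: "\<And>k. 0 < t k" and u: "\<And>k. 0 \<le> u k" and x: "0 \<le> x" "x < 1"
    and le: "\<And>k. u k * (A / t k) \<le> B * x ^ k"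
    and g: "\<And>z. z \<in> space M \<Longrightarrow> g z \<noteq> 0 \<Longrightarrow> \<exists>k. g z \<le> ennreal (u k) \<and> t k \<le> K z"
    and A: "0 \<le> A"
  shows "(\<integral>\<^sup>+z. g z \<partial>M) \<le> ennreal (B / (1 - x))"
proof -
  have B: "0 \<le> B * x ^ k" for k
    using le[of k] u[of k] t[of k] A by (smt (verit) divide_nonneg_pos mult_nonneg_nonneg)
  have "(\<integral>\<^sup>+z. g z \<partial>M) \<le> (\<integral>\<^sup>+z. (\<Sum>k. ennreal (u k) * indicator {z \<in> space M. t k \<le> K z} z) \<partial>M)"
  proof (rule nn_integral_mono)
    fix z assume z: "z \<in> space M"
    let ?T = "\<lambda>k. ennreal (u k) * indicator {z \<in> space M. t k \<le> K z} z"
    show "g z \<le> (\<Sum>k. ?T k)"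
    proof (cases "g z = 0")
      case False
      then obtain k where k: "g z \<le> ennreal (u k)" "t k \<le> K z" using g z by blast
      have term_le: "f k \<le> suminf f" for f :: "nat \<Rightarrow> ennreal"
        using sum_le_suminf[of f "{k}"] by simp
      have "g z \<le> ?T k" using k z by simp
      also have "\<dots> \<le> (\<Sum>k. ?T k)" by (rule term_le)
      finally show ?thesis .
    qed simp
  qed
  also have "\<dots> = (\<Sum>k. \<integral>\<^sup>+z. ennreal (u k) * indicator {z \<in> space M. t k \<le> K z} z \<partial>M)"
    by (rule nn_integral_suminf) measurable
  also have "\<dots> = (\<Sum>k. ennreal (u k) * emeasure M {z \<in> space M. t k \<le> K z})"
    by (intro suminf_cong nn_integral_cmult_indicator) measurable
  also have "\<dots> \<le> (\<Sum>k. ennreal (B * x ^ k))"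
  proof (intro suminf_le)
    fix k
    have "ennreal (u k) * emeasure M {z \<in> space M. t k \<le> K z} \<le> ennreal (u k) * ennreal (A / t k)"
      by (intro mult_left_mono weak t) auto
    also have "\<dots> = ennreal (u k * (A / t k))"
      using u[of k] t[of k] A by (intro ennreal_mult[symmetric]) auto
    also have "\<dots> \<le> ennreal (B * x ^ k)" using le by (rule ennreal_leI)
    finally show "ennreal (u k) * emeasure M {z \<in> space M. t k \<le> K z} \<le> ennreal (B * x ^ k)" .
  qed auto
  also have "\<dots> = ennreal (B / (1 - x))"
  proof (rule suminf_ennreal_eq[OF B])
    have "(\<lambda>k. B * x ^ k) sums (B * (1 / (1 - x)))" by (intro sums_mult geometric_sums) (use x in auto)
    then show "(\<lambda>k. B * x ^ k) sums (B / (1 - x))" by simp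
  qed
  finally show ?thesis .
qed

lemma ex_dyadic_interval:
  fixes y :: real
  assumes "1 \<le> y"
  obtains k where "2 ^ k \<le> y" "y < 2 ^ Suc k"
proof -
  obtain n where "y < 2 ^ n" using real_arch_pow[of 2 y] by auto
  then obtain k where "k < n" "\<forall>i\<le>k. \<not> y < 2 ^ i" "y < 2 ^ Suc k"
    using ex_least_nat_less[of "\<lambda>n. y < 2 ^ n" n] assms by auto
  then show ?thesis using that[of k] by auto
qed

text \<open>
  On \<open>2 ^ k * s \<le> K < 2 ^ Suc k * s\<close> the integrand is at most \<open>(2 ^ Suc k * s) powr c\<close>, on a set of
  measure at most \<open>A / (2 ^ k * s)\<close>. The product decays in \<open>k\<close> like \<open>2 powr (c - 1)\<close> to the power \<open>k\<close>,
  because \<open>c < 1\<close>.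
\<close>

lemma weak_L1_integral_upper_part:
  fixes K :: "'a \<Rightarrow> real"
  assumes K [measurable]: "K \<in> borel_measurable M" and A: "0 \<le> A"
    and weak: "\<And>t. 0 < t \<Longrightarrow> emeasure M {z \<in> space M. t \<le> K z} \<le> ennreal (A / t)"
    and c: "0 < c" "c < 1" and s: "0 < s"
  shows "(\<integral>\<^sup>+z. ennreal (K z powr c) * indicator {z. s \<le> K z} z \<partial>M)
    \<le> ennreal (A * s powr (c - 1) * 2 powr c / (1 - 2 powr (c - 1)))"
proof (rule nn_integral_le_geometric[OF K weak,
      where t = "\<lambda>k. 2 ^ k * s" and u = "\<lambda>k. (2 ^ Suc k * s) powr c"])
  show "2 powr (c - 1) < (1::real)" using c powr_less_mono[of "c - 1" 0 2] by simp
  show "(2 ^ Suc k * s) powr c * (A / (2 ^ k * s)) \<le> A * s powr (c - 1) * 2 powr c * (2 powr (c - 1)) ^ k" for k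
  proof -
    have 1: "(2 ^ Suc k * s) powr c = 2 powr c * (2 ^ k) powr c * s powr c"
      using s by (simp add: powr_mult)
    have 2: "(2 powr (c - 1)) ^ k = (2 ^ k) powr c / 2 ^ k"
      by (simp add: powr_diff powr_power power_divide flip: powr_realpow powr_powr powr_mult_base)
        (simp add: powr_powr mult.commute powr_realpow[symmetric])
    have 3: "s powr (c - 1) = s powr c / s" using s by (simp add: powr_diff)
    show ?thesis by (simp only: 1 2 3) (simp add: field_simps)
  qed
  fix z assume "ennreal (K z powr c) * indicator {z. s \<le> K z} z \<noteq> 0"
  then have z: "s \<le> K z" by (auto split: split_indicator_asm)
  then obtain k where k: "2 ^ k \<le> K z / s" "K z / s < 2 ^ Suc k"
    using ex_dyadic_interval[of "K z / s"] s by (auto simp: field_simps)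
  then have "K z \<le> 2 ^ Suc k * s" "2 ^ k * s \<le> K z" using s by (auto simp: field_simps)
  then show "\<exists>k. ennreal (K z powr c) * indicator {z. s \<le> K z} z \<le> ennreal ((2 ^ Suc k * s) powr c)
      \<and> 2 ^ k * s \<le> K z"
    using z s c by (intro exI[of _ k]) (auto intro!: ennreal_leI powr_mono2)
qed (use s A in auto)

text \<open>
  The dyadic levels now go down to \<open>0\<close>: the measures grow like \<open>2 ^ k\<close>, but \<open>q > 1\<close> makes the
  integrand decay faster.
\<close>

lemma weak_L1_integral_lower_part:
  fixes K :: "'a \<Rightarrow> real"
  assumes K [measurable]: "K \<in> borel_measurable M" and A: "0 \<le> A"
    and weak: "\<And>t. 0 < t \<Longrightarrow> emeasure M {z \<in> space M. t \<le> K z} \<le> ennreal (A / t)"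
    and q: "1 < q" and s: "0 < s"
  shows "(\<integral>\<^sup>+z. ennreal (K z powr q) * indicator {z. 0 < K z \<and> K z \<le> s} z \<partial>M)
    \<le> ennreal (A * s powr (q - 1) * 2 / (1 - 2 powr (1 - q)))"
proof (rule nn_integral_le_geometric[OF K weak,
      where t = "\<lambda>k. s / 2 ^ Suc k" and u = "\<lambda>k. (s / 2 ^ k) powr q"])
  show "2 powr (1 - q) < (1::real)" using q powr_less_mono[of "1 - q" 0 2] by simp
  show "(s / 2 ^ k) powr q * (A / (s / 2 ^ Suc k)) \<le> A * s powr (q - 1) * 2 * (2 powr (1 - q)) ^ k" for k
  proof -
    have 1: "(s / 2 ^ k) powr q = s powr q / (2 ^ k) powr q"
      using s by (simp add: powr_divide)
    have 2: "(2 powr (1 - q)) ^ k = 2 ^ k / (2 ^ k) powr q"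
      by (simp add: powr_diff powr_power power_divide flip: powr_realpow powr_powr powr_mult_base)
        (simp add: powr_powr mult.commute powr_realpow[symmetric])
    have 3: "s powr (q - 1) = s powr q / s" using s by (simp add: powr_diff)
    show ?thesis by (simp only: 1 2 3) (simp add: field_simps)
  qed
  fix z assume "ennreal (K z powr q) * indicator {z. 0 < K z \<and> K z \<le> s} z \<noteq> 0"
  then have z: "0 < K z" "K z \<le> s" by (auto split: split_indicator_asm)
  then obtain k where k: "2 ^ k \<le> s / K z" "s / K z < 2 ^ Suc k"
    using ex_dyadic_interval[of "s / K z"] s by (auto simp: field_simps)
  then have "K z \<le> s / 2 ^ k" "s / 2 ^ Suc k \<le> K z" using s z by (auto simp: field_simps)
  then show "\<exists>k. ennreal (K z powr q) * indicator {z. 0 < K z \<and> K z \<le> s} z \<le> ennreal ((s / 2 ^ k) powr q)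
      \<and> s / 2 ^ Suc k \<le> K z"
    using z s q by (intro exI[of _ k]) (auto intro!: ennreal_leI powr_mono2)
qed (use s A in auto)

text \<open>
  The summands belong to the regions \<open>K \<le> F\<close>, \<open>F \<le> K \<le> s\<close> and \<open>s \<le> K\<close>, in this order.
\<close>

definition slice_const :: "real \<Rightarrow> real \<Rightarrow> real \<Rightarrow> real" where
  "slice_const A a c =
     1 + A * (2 / (1 - 2 powr (1 - (a + c))) + 2 powr c / (1 - 2 powr (c - 1)))"

lemma slice_const_ge_1:
  assumes "0 \<le> A" "c < 1" "1 < a + c"
  shows "1 \<le> slice_const A a c"
proof -
  have "2 powr (1 - (a + c)) < (1::real)" "2 powr (c - 1) < (1::real)"
    using assms powr_less_mono[of "1 - (a + c)" 0 2] powr_less_mono[of "c - 1" 0 2] by auto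
  then show ?thesis using assms(1) by (auto simp: slice_const_def intro!: mult_nonneg_nonneg add_nonneg_nonneg)
qed

text \<open>
  Where \<open>F\<close> dominates \<open>K\<close>, the product is only bounded by \<open>F powr (a + c)\<close>, whose exponent exceeds \<open>1\<close>;
  the truncation \<open>F \<le> s\<close> reduces it to \<open>s powr (a + c - 1) * F\<close>. Where \<open>K\<close> dominates \<open>F\<close>, the level \<open>s\<close>
  separates the values of \<open>K\<close> for which the exponent \<open>a + c > 1\<close> is integrable from those for which
  \<open>c < 1\<close> is. All three regions scale like the same power of \<open>s\<close>.
\<close>

lemma weak_L1_product_slice:
  fixes F K :: "'a \<Rightarrow> real"
  assumes F [measurable]: "F \<in> borel_measurable M" and F0: "\<And>z. 0 \<le> F z"
    and F1: "(\<integral>\<^sup>+z. ennreal (F z) \<partial>M) \<le> 1"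
    and K [measurable]: "K \<in> borel_measurable M" and K0: "\<And>z. 0 \<le> K z" and A: "0 \<le> A"
    and weak: "\<And>t. 0 < t \<Longrightarrow> emeasure M {z \<in> space M. t \<le> K z} \<le> ennreal (A / t)"
    and ac: "0 < a" "0 < c" "c < 1" "1 < a + c" and s: "0 < s"
  shows "(\<integral>\<^sup>+z. ennreal (F z powr a * K z powr c) * indicator {z. F z \<le> s} z \<partial>M)
    \<le> ennreal (slice_const A a c * s powr (a + c - 1))"
proof -
  let ?q = "a + c"
  let ?L = "\<lambda>z. ennreal (K z powr ?q) * indicator {z. 0 < K z \<and> K z \<le> s} z"
  let ?U = "\<lambda>z. ennreal (K z powr c) * indicator {z. s \<le> K z} z"
  have pointwise: "ennreal (F z powr a * K z powr c) * indicator {z. F z \<le> s} z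
      \<le> ennreal (s powr (?q - 1)) * ennreal (F z) + ?L z + ennreal (s powr a) * ?U z" for z
  proof (cases "F z \<le> s \<and> 0 < F z \<and> 0 < K z")
    case True
    then have z: "F z \<le> s" "0 < F z" "0 < K z" by auto
    \<comment> \<open>Each region contributes one of the three summands; the other two are simply nonnegative.\<close>
    consider "K z \<le> F z" | "F z \<le> K z" "K z \<le> s" | "s \<le> K z" using z by linarith
    then show ?thesis
    proof cases
      case 1
      have "F z powr a * K z powr c \<le> F z powr a * F z powr c"
        using 1 z ac by (intro mult_left_mono powr_mono2) auto
      also have "\<dots> = F z powr (?q - 1) * F z" using z by (simp add: powr_add powr_diff)
      also have "\<dots> \<le> s powr (?q - 1) * F z"
        using z ac by (intro mult_right_mono powr_mono2) auto
      finally have "ennreal (F z powr a * K z powr c) * indicator {z. F z \<le> s} z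
        \<le> ennreal (s powr (?q - 1)) * ennreal (F z)"
        using z by (simp add: ennreal_leI flip: ennreal_mult)
      then show ?thesis by (simp add: add_increasing2 add.assoc)
    next
      case 2
      have "F z powr a * K z powr c \<le> K z powr a * K z powr c"
        using 2 z ac by (intro mult_right_mono powr_mono2) auto
      then have "ennreal (F z powr a * K z powr c) * indicator {z. F z \<le> s} z \<le> ?L z"
        using z 2 by (simp add: ennreal_leI powr_add)
      then show ?thesis by (simp add: add_increasing add_increasing2)
    next
      case 3
      have "F z powr a * K z powr c \<le> s powr a * K z powr c"
        using z ac by (intro mult_right_mono powr_mono2) auto
      then have "ennreal (F z powr a * K z powr c) * indicator {z. F z \<le> s} z \<le> ennreal (s powr a) * ?U z"
        using z 3 by (simp add: ennreal_leI flip: ennreal_mult)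
      then show ?thesis by (simp add: add_increasing)
    qed
  next
    case False
    then have "ennreal (F z powr a * K z powr c) * indicator {z. F z \<le> s} z = 0"
      using F0[of z] K0[of z] by (auto split: split_indicator)
    then show ?thesis by (simp only: zero_le)
  qed
  have den: "0 < 1 - 2 powr (1 - ?q)" "0 < 1 - 2 powr (c - 1)"
    using ac powr_less_mono[of "1 - ?q" 0 2] powr_less_mono[of "c - 1" 0 2] by auto
  have "(\<integral>\<^sup>+z. ennreal (F z powr a * K z powr c) * indicator {z. F z \<le> s} z \<partial>M)
      \<le> (\<integral>\<^sup>+z. ennreal (s powr (?q - 1)) * ennreal (F z) + ?L z + ennreal (s powr a) * ?U z \<partial>M)"
    by (intro nn_integral_mono pointwise)
  also have "\<dots> = ennreal (s powr (?q - 1)) * (\<integral>\<^sup>+z. ennreal (F z) \<partial>M) + (\<integral>\<^sup>+z. ?L z \<partial>M)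
      + ennreal (s powr a) * (\<integral>\<^sup>+z. ?U z \<partial>M)"
    by (simp add: nn_integral_add nn_integral_cmult)
  also have "\<dots> \<le> ennreal (s powr (?q - 1)) * 1 + ennreal (A * s powr (?q - 1) * 2 / (1 - 2 powr (1 - ?q)))
      + ennreal (s powr a) * ennreal (A * s powr (c - 1) * 2 powr c / (1 - 2 powr (c - 1)))"
    by (intro add_mono mult_left_mono F1 weak_L1_integral_lower_part weak_L1_integral_upper_part
        weak K A ac s) auto
  also have "\<dots> = ennreal (s powr (?q - 1) + A * s powr (?q - 1) * 2 / (1 - 2 powr (1 - ?q))
      + s powr a * (A * s powr (c - 1) * 2 powr c / (1 - 2 powr (c - 1))))"
    using A den s by (simp add: ennreal_plus del: times_divide_eq_right flip: ennreal_mult)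
  also have "s powr (?q - 1) + A * s powr (?q - 1) * 2 / (1 - 2 powr (1 - ?q))
      + s powr a * (A * s powr (c - 1) * 2 powr c / (1 - 2 powr (c - 1)))
      = slice_const A a c * s powr (?q - 1)"
  proof -
    have "s powr a * s powr (c - 1) = s powr (?q - 1)"
      by (simp add: powr_add[symmetric] algebra_simps)
    then have "s powr a * (A * s powr (c - 1) * 2 powr c / (1 - 2 powr (c - 1)))
        = A * s powr (?q - 1) * 2 powr c / (1 - 2 powr (c - 1))"
      by (metis (no_types) mult.assoc mult.left_commute times_divide_eq_right)
    then show ?thesis by (simp add: slice_const_def algebra_simps)
  qed
  finally show ?thesis .
qed


section \<open>Kernels of weak type on sigma-finite spaces\<close>

text \<open>
  The slice estimate with \<open>s = H w\<close> yields \<open>H w powr (b + (a + c - 1)) = H w\<close>, so only the integral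
  of \<open>H\<close> remains. The points with \<open>H w = 0\<close>, where \<open>s > 0\<close> fails, contribute \<open>0\<close>.
\<close>

lemma weak_kernel_half_integral:
  fixes F :: "'a \<Rightarrow> real" and H :: "'b \<Rightarrow> real" and K :: "'a \<times> 'b \<Rightarrow> real"
  assumes F [measurable]: "F \<in> borel_measurable M" and F0: "\<And>z. 0 \<le> F z"
    and F1: "(\<integral>\<^sup>+z. ennreal (F z) \<partial>M) \<le> 1"
    and H [measurable]: "H \<in> borel_measurable N" and H0: "\<And>w. 0 \<le> H w"
    and H1: "(\<integral>\<^sup>+w. ennreal (H w) \<partial>N) \<le> 1"
    and K [measurable]: "K \<in> borel_measurable (M \<Otimes>\<^sub>M N)" and K0: "\<And>x. 0 \<le> K x" and A: "0 \<le> A"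
    and weak: "\<And>w t. w \<in> space N \<Longrightarrow> 0 < t \<Longrightarrow>
      emeasure M {z \<in> space M. t \<le> K (z, w)} \<le> ennreal (A / t)"
    and abc: "0 < a" "0 < c" "c < 1" "b < 1" "a + b + c = 2"
  shows "(\<integral>\<^sup>+w. \<integral>\<^sup>+z. ennreal (F z powr a * H w powr b * K (z, w) powr c)
      * indicator {z. F z \<le> H w} z \<partial>M \<partial>N) \<le> ennreal (slice_const A a c)"
proof -
  have C: "1 \<le> slice_const A a c" using A abc by (intro slice_const_ge_1) auto
  have "(\<integral>\<^sup>+w. \<integral>\<^sup>+z. ennreal (F z powr a * H w powr b * K (z, w) powr c)
      * indicator {z. F z \<le> H w} z \<partial>M \<partial>N) \<le> (\<integral>\<^sup>+w. ennreal (slice_const A a c) * ennreal (H w) \<partial>N)"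
  proof (rule nn_integral_mono)
    fix w assume w: "w \<in> space N"
    show "(\<integral>\<^sup>+z. ennreal (F z powr a * H w powr b * K (z, w) powr c) * indicator {z. F z \<le> H w} z \<partial>M)
      \<le> ennreal (slice_const A a c) * ennreal (H w)"
    proof (cases "H w = 0")
      case False
      then have Hw: "0 < H w" using H0[of w] by auto
      have [measurable]: "(\<lambda>z. K (z, w)) \<in> borel_measurable M" using w by measurable
      have "(\<integral>\<^sup>+z. ennreal (F z powr a * H w powr b * K (z, w) powr c) * indicator {z. F z \<le> H w} z \<partial>M)
        = (\<integral>\<^sup>+z. ennreal (H w powr b) * (ennreal (F z powr a * K (z, w) powr c) * indicator {z. F z \<le> H w} z) \<partial>M)"
        by (intro nn_integral_cong) (simp add: ennreal_mult mult_ac)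
      also have "\<dots> = ennreal (H w powr b)
          * (\<integral>\<^sup>+z. ennreal (F z powr a * K (z, w) powr c) * indicator {z. F z \<le> H w} z \<partial>M)"
        by (rule nn_integral_cmult) measurable
      also have "\<dots> \<le> ennreal (H w powr b) * ennreal (slice_const A a c * H w powr (a + c - 1))"
        using abc w Hw by (intro mult_left_mono weak_L1_product_slice F F0 F1 K0 A weak) auto
      also have "\<dots> = ennreal (slice_const A a c * (H w powr b * H w powr (a + c - 1)))"
        using C by (simp add: mult_ac flip: ennreal_mult)
      also have "H w powr b * H w powr (a + c - 1) = H w"
      proof -
        have "b + (a + c - 1) = 1" using abc by simp
        then show ?thesis using Hw by (simp only: powr_add[symmetric]) simp
      qed
      finally show ?thesis using C Hw by (simp add: ennreal_mult)
    qed simp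
  qed
  also have "\<dots> = ennreal (slice_const A a c) * (\<integral>\<^sup>+w. ennreal (H w) \<partial>N)"
    by (rule nn_integral_cmult) measurable
  also have "\<dots> \<le> ennreal (slice_const A a c) * 1" by (intro mult_left_mono H1) auto
  finally show ?thesis by simp
qed

text \<open>
  The half \<open>H w \<le> F z\<close> is the other half after exchanging the two spaces; Tonelli's theorem lets each
  half be integrated in the order that suits it. This is why \<open>K\<close> must be of weak type in both
  variables.
\<close>

lemma weak_kernel_HLS_normalised:
  fixes F :: "'a \<Rightarrow> real" and H :: "'b \<Rightarrow> real" and K :: "'a \<times> 'b \<Rightarrow> real"
  assumes "sigma_finite_measure M" "sigma_finite_measure N"
    and F [measurable]: "F \<in> borel_measurable M" and F0: "\<And>z. 0 \<le> F z"
    and F1: "(\<integral>\<^sup>+z. ennreal (F z) \<partial>M) \<le> 1"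
    and H [measurable]: "H \<in> borel_measurable N" and H0: "\<And>w. 0 \<le> H w"
    and H1: "(\<integral>\<^sup>+w. ennreal (H w) \<partial>N) \<le> 1"
    and K [measurable]: "K \<in> borel_measurable (M \<Otimes>\<^sub>M N)" and K0: "\<And>x. 0 \<le> K x" and A: "0 \<le> A"
    and weak1: "\<And>w t. w \<in> space N \<Longrightarrow> 0 < t \<Longrightarrow>
      emeasure M {z \<in> space M. t \<le> K (z, w)} \<le> ennreal (A / t)"
    and weak2: "\<And>z t. z \<in> space M \<Longrightarrow> 0 < t \<Longrightarrow>
      emeasure N {w \<in> space N. t \<le> K (z, w)} \<le> ennreal (A / t)"
    and abc: "0 < a" "a < 1" "0 < b" "b < 1" "0 < c" "c < 1" "a + b + c = 2"
  shows "(\<integral>\<^sup>+(z, w). ennreal (F z powr a * H w powr b * K (z, w) powr c) \<partial>(M \<Otimes>\<^sub>M N))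
    \<le> ennreal (slice_const A a c + slice_const A b c)"
proof -
  interpret M: sigma_finite_measure M by fact
  interpret N: sigma_finite_measure N by fact
  interpret pair_sigma_finite M N ..
  let ?g = "\<lambda>(z, w). ennreal (F z powr a * H w powr b * K (z, w) powr c)"
  let ?G = "\<lambda>(z, w). ?g (z, w) * indicator {z. F z \<le> H w} z"
  let ?G' = "\<lambda>(z, w). ?g (z, w) * indicator {w. H w \<le> F z} w"
  have G: "?G \<in> borel_measurable (M \<Otimes>\<^sub>M N)" "?G' \<in> borel_measurable (M \<Otimes>\<^sub>M N)"
    unfolding indicator_def by simp_all
  have "integral\<^sup>N (M \<Otimes>\<^sub>M N) ?g \<le> (\<integral>\<^sup>+x. ?G x + ?G' x \<partial>(M \<Otimes>\<^sub>M N))"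
    by (intro nn_integral_mono) (auto split: split_indicator simp: not_le)
  also have "\<dots> = integral\<^sup>N (M \<Otimes>\<^sub>M N) ?G + integral\<^sup>N (M \<Otimes>\<^sub>M N) ?G'"
    by (rule nn_integral_add[OF G])
  also have "integral\<^sup>N (M \<Otimes>\<^sub>M N) ?G = (\<integral>\<^sup>+w. \<integral>\<^sup>+z. ?G (z, w) \<partial>M \<partial>N)"
    by (rule nn_integral_snd[OF G(1), symmetric])
  also have "integral\<^sup>N (M \<Otimes>\<^sub>M N) ?G' = (\<integral>\<^sup>+z. \<integral>\<^sup>+w. ?G' (z, w) \<partial>N \<partial>M)"
    by (rule N.nn_integral_fst[OF G(2), symmetric])
  also have "(\<integral>\<^sup>+w. \<integral>\<^sup>+z. ?G (z, w) \<partial>M \<partial>N) + (\<integral>\<^sup>+z. \<integral>\<^sup>+w. ?G' (z, w) \<partial>N \<partial>M)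
      \<le> ennreal (slice_const A a c) + ennreal (slice_const A b c)"
  proof (rule add_mono)
    show "(\<integral>\<^sup>+w. \<integral>\<^sup>+z. ?G (z, w) \<partial>M \<partial>N) \<le> ennreal (slice_const A a c)"
      using weak_kernel_half_integral[OF F F0 F1 H H0 H1 K K0 A weak1, of a c b] abc by simp
    have "(\<lambda>(w, z). K (z, w)) \<in> borel_measurable (N \<Otimes>\<^sub>M M)" by measurable
    from weak_kernel_half_integral[OF H H0 H1 F F0 F1 this, of A b c a] K0 A weak2 abc
    have "(\<integral>\<^sup>+z. \<integral>\<^sup>+w. ennreal (H w powr b * F z powr a * K (z, w) powr c)
        * indicator {w. H w \<le> F z} w \<partial>N \<partial>M) \<le> ennreal (slice_const A b c)"
      by (simp add: split_beta')
    moreover have "H w powr b * F z powr a * K (z, w) powr c = F z powr a * H w powr b * K (z, w) powr c" for z w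
      by simp
    ultimately show "(\<integral>\<^sup>+z. \<integral>\<^sup>+w. ?G' (z, w) \<partial>N \<partial>M) \<le> ennreal (slice_const A b c)"
      by (simp only: prod.case)
  qed
  also have "\<dots> = ennreal (slice_const A a c + slice_const A b c)"
    using slice_const_ge_1[of A c a] slice_const_ge_1[of A c b] A abc by simp
  finally show ?thesis .
qed

text \<open>
  Homogeneity in \<open>f\<close> and in \<open>h\<close> reduces the claim to the normalised one. A function of norm \<open>0\<close> cannot be
  normalised, but it vanishes almost everywhere, and both sides are \<open>0\<close>. The bound
  is shown for the absolute value of the integrand, which gives integrability as well.
\<close>

lemma weak_kernel_HLS:
  fixes f :: "'a \<Rightarrow> real" and h :: "'b \<Rightarrow> real" and K :: "'a \<times> 'b \<Rightarrow> real"
  assumes sf: "sigma_finite_measure M" "sigma_finite_measure N"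
    and f: "f \<in> Lp_space p M" and h: "h \<in> Lp_space r N"
    and K [measurable]: "K \<in> borel_measurable (M \<Otimes>\<^sub>M N)" and K0: "\<And>x. 0 \<le> K x" and A: "0 \<le> A"
    and weak1: "\<And>w t. w \<in> space N \<Longrightarrow> 0 < t \<Longrightarrow>
      emeasure M {z \<in> space M. t \<le> K (z, w)} \<le> ennreal (A / t)"
    and weak2: "\<And>z t. z \<in> space M \<Longrightarrow> 0 < t \<Longrightarrow>
      emeasure N {w \<in> space N. t \<le> K (z, w)} \<le> ennreal (A / t)"
    and prc: "1 < p" "1 < r" "0 < c" "c < 1" "1 / p + c + 1 / r = 2"
  defines "C \<equiv> slice_const A (1 / p) c + slice_const A (1 / r) c"
  shows "integrable (M \<Otimes>\<^sub>M N) (\<lambda>(z, w). f z * h w * K (z, w) powr c)" (is ?integrable)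
    and "(LINT w|N. LINT z|M. f z * h w * K (z, w) powr c) \<le> C * Lp_norm p M f * Lp_norm r N h" (is ?bound)
proof -
  interpret M: sigma_finite_measure M by fact
  interpret N: sigma_finite_measure N by fact
  interpret pair_sigma_finite M N ..
  have [measurable]: "f \<in> borel_measurable M" "h \<in> borel_measurable N"
    and int: "integrable M (\<lambda>z. \<bar>f z\<bar> powr p)" "integrable N (\<lambda>w. \<bar>h w\<bar> powr r)"
    using f h by (auto simp: Lp_space_def)
  define P where "P = (LINT z|M. \<bar>f z\<bar> powr p)"
  define R where "R = (LINT w|N. \<bar>h w\<bar> powr r)"
  have PR0: "0 \<le> P" "0 \<le> R" by (simp_all add: P_def R_def)
  have nn: "(\<integral>\<^sup>+z. ennreal (\<bar>f z\<bar> powr p) \<partial>M) = ennreal P" "(\<integral>\<^sup>+w. ennreal (\<bar>h w\<bar> powr r) \<partial>N) = ennreal R"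
    unfolding P_def R_def by (intro nn_integral_eq_integral int; simp)+
  have pr1: "1 / p < 1" "1 / r < 1" using prc by auto
  have C: "1 \<le> C"
    using slice_const_ge_1[of A c "1 / p"] slice_const_ge_1[of A c "1 / r"] A prc pr1 unfolding C_def by linarith
  let ?B = "C * Lp_norm p M f * Lp_norm r N h"
  have B0: "0 \<le> ?B" using C by (simp add: Lp_norm_def)
  let ?g = "\<lambda>(z, w). f z * h w * K (z, w) powr c"
  have gm [measurable]: "?g \<in> borel_measurable (M \<Otimes>\<^sub>M N)" by measurable
  have bound: "(\<integral>\<^sup>+x. ennreal (norm (?g x)) \<partial>(M \<Otimes>\<^sub>M N)) \<le> ennreal ?B"
  proof (cases "P = 0 \<or> R = 0")
    case True
    have "(\<integral>\<^sup>+x. ennreal (norm (?g x)) \<partial>(M \<Otimes>\<^sub>M N)) = 0"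
      using True
    proof
      assume "P = 0"
      then have "AE z in M. f z = 0" using nn(1) by (simp add: nn_integral_0_iff_AE)
      moreover have "(\<integral>\<^sup>+w. ennreal (norm (?g (z, w))) \<partial>N) = 0" if "f z = 0" for z using that by simp
      ultimately have "(\<integral>\<^sup>+z. \<integral>\<^sup>+w. ennreal (norm (?g (z, w))) \<partial>N \<partial>M) = (\<integral>\<^sup>+z. 0 \<partial>M)"
        by (intro nn_integral_cong_AE) (auto elim: eventually_mono)
      then show ?thesis by (subst N.nn_integral_fst[symmetric]) auto
    next
      assume "R = 0"
      then have "AE w in N. h w = 0" using nn(2) by (simp add: nn_integral_0_iff_AE)
      then have "(\<integral>\<^sup>+w. \<integral>\<^sup>+z. ennreal (norm (?g (z, w))) \<partial>M \<partial>N) = (\<integral>\<^sup>+w. 0 \<partial>N)"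
        by (intro nn_integral_cong_AE) (auto elim: eventually_mono)
      then show ?thesis by (subst nn_integral_snd[symmetric]) auto
    qed
    then show ?thesis by simp
  next
    case False
    then have PR: "0 < P" "0 < R" using PR0 by auto
    define F where "F z = \<bar>f z\<bar> powr p / P" for z
    define H where "H w = \<bar>h w\<bar> powr r / R" for w
    have [measurable]: "F \<in> borel_measurable M" "H \<in> borel_measurable N"
      unfolding F_def H_def by measurable
    have "(\<integral>\<^sup>+z. ennreal (F z) \<partial>M) = (\<integral>\<^sup>+z. ennreal (\<bar>f z\<bar> powr p) / ennreal P \<partial>M)"
      using PR by (intro nn_integral_cong) (simp add: F_def divide_ennreal)
    also have "\<dots> = ennreal P / ennreal P" by (subst nn_integral_divide) (simp_all add: nn)
    also have "\<dots> \<le> 1" using PR by (simp add: divide_ennreal)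
    finally have F1: "(\<integral>\<^sup>+z. ennreal (F z) \<partial>M) \<le> 1" .
    have "(\<integral>\<^sup>+w. ennreal (H w) \<partial>N) = (\<integral>\<^sup>+w. ennreal (\<bar>h w\<bar> powr r) / ennreal R \<partial>N)"
      using PR by (intro nn_integral_cong) (simp add: H_def divide_ennreal)
    also have "\<dots> = ennreal R / ennreal R" by (subst nn_integral_divide) (simp_all add: nn)
    also have "\<dots> \<le> 1" using PR by (simp add: divide_ennreal)
    finally have H1: "(\<integral>\<^sup>+w. ennreal (H w) \<partial>N) \<le> 1" .
    have normalise: "norm (?g (z, w))
        = Lp_norm p M f * Lp_norm r N h * (F z powr (1 / p) * H w powr (1 / r) * K (z, w) powr c)" for z w
      using PR prc
      by (simp add: F_def H_def Lp_norm_def P_def[symmetric] R_def[symmetric] powr_divide powr_powr abs_mult)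
    have "(\<integral>\<^sup>+x. ennreal (norm (?g x)) \<partial>(M \<Otimes>\<^sub>M N))
        = (\<integral>\<^sup>+x. ennreal (Lp_norm p M f * Lp_norm r N h)
            * (\<lambda>(z, w). ennreal (F z powr (1 / p) * H w powr (1 / r) * K (z, w) powr c)) x \<partial>(M \<Otimes>\<^sub>M N))"
    proof (intro nn_integral_cong)
      fix x assume "x \<in> space (M \<Otimes>\<^sub>M N)"
      obtain z w where "x = (z, w)" by fastforce
      then show "ennreal (norm (?g x)) = ennreal (Lp_norm p M f * Lp_norm r N h)
            * (\<lambda>(z, w). ennreal (F z powr (1 / p) * H w powr (1 / r) * K (z, w) powr c)) x"
        using normalise[of z w] by (simp add: Lp_norm_def flip: ennreal_mult)
    qed
    also have "\<dots> = ennreal (Lp_norm p M f * Lp_norm r N h)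
        * (\<integral>\<^sup>+(z, w). ennreal (F z powr (1 / p) * H w powr (1 / r) * K (z, w) powr c) \<partial>(M \<Otimes>\<^sub>M N))"
      by (rule nn_integral_cmult) measurable
    also have "\<dots> \<le> ennreal (Lp_norm p M f * Lp_norm r N h) * ennreal C"
      unfolding C_def using prc PR
      by (intro mult_left_mono weak_kernel_HLS_normalised sf F1 H1 K K0 A weak1 weak2)
        (auto simp: F_def H_def)
    also have "\<dots> = ennreal ?B" using C by (simp add: Lp_norm_def mult_ac flip: ennreal_mult)
    finally show ?thesis .
  qed
  show int: ?integrable
    using bound by (intro integrableI_bounded gm) (auto simp: le_less_trans)
  have "(LINT w|N. LINT z|M. f z * h w * K (z, w) powr c) = (LINT x|(M \<Otimes>\<^sub>M N). ?g x)"
    using integral_snd[of "\<lambda>z w. f z * h w * K (z, w) powr c"] int by simp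
  also have "\<dots> \<le> (LINT x|(M \<Otimes>\<^sub>M N). norm (?g x))"
    using int by (intro integral_mono integrable_norm) auto
  also have "\<dots> \<le> ?B"
  proof -
    have "ennreal (LINT x|(M \<Otimes>\<^sub>M N). norm (?g x)) \<le> ennreal ?B"
      using bound int by (subst nn_integral_eq_integral[symmetric]) (auto intro: integrable_norm)
    then show ?thesis using B0 by (simp only: ennreal_le_iff)
  qed
  finally show ?bound .
qed

section \<open>Lebesgue measure and the homogeneous norm\<close>

lemma sigma_finite_completion:
  assumes "sigma_finite_measure M"
  shows "sigma_finite_measure (completion M)"
proof -
  interpret sigma_finite_measure M by fact
  obtain S where "countable S" "S \<subseteq> sets M" "\<Union>S = space M" "\<forall>a\<in>S. emeasure M a \<noteq> \<infinity>"
    using sigma_finite_countable by auto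
  then show ?thesis
    by (intro sigma_finite_measure.intro exI[of _ S]) auto
qed

lemma sigma_finite_lebesgue_Rn: "sigma_finite_measure (lebesgue_Rn N)"
proof -
  interpret product_sigma_finite "\<lambda>_::nat. lborel :: real measure" ..
  show ?thesis unfolding lebesgue_Rn_def by (intro sigma_finite_completion sigma_finite) simp
qed

lemma space_lebesgue_Rn: "space (lebesgue_Rn N) = (\<Pi>\<^sub>E i\<in>{..<N}. UNIV)"
  by (simp add: lebesgue_Rn_def space_PiM)

lemma emeasure_lebesgue_Rn_box:
  assumes "\<And>i. i < N \<Longrightarrow> 0 \<le> \<delta> i"
  shows "(\<Pi>\<^sub>E i\<in>{..<N}. {w i - \<delta> i..w i + \<delta> i}) \<in> sets (lebesgue_Rn N)"
    and "emeasure (lebesgue_Rn N) (\<Pi>\<^sub>E i\<in>{..<N}. {w i - \<delta> i..w i + \<delta> i}) = ennreal (\<Prod>i<N. 2 * \<delta> i)"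
proof -
  interpret product_sigma_finite "\<lambda>_::nat. lborel :: real measure" ..
  let ?X = "\<Pi>\<^sub>E i\<in>{..<N}. {w i - \<delta> i..w i + \<delta> i}"
  have X: "?X \<in> sets (\<Pi>\<^sub>M i\<in>{..<N}. lborel)" by (intro sets_PiM_I_finite) auto
  then show "?X \<in> sets (lebesgue_Rn N)" by (simp add: lebesgue_Rn_def)
  have "emeasure (lebesgue_Rn N) ?X = emeasure (\<Pi>\<^sub>M i\<in>{..<N}. lborel) ?X"
    using X by (simp add: lebesgue_Rn_def)
  also have "\<dots> = (\<Prod>i<N. emeasure lborel {w i - \<delta> i..w i + \<delta> i})"
    by (rule emeasure_PiM) auto
  also have "\<dots> = (\<Prod>i<N. ennreal (2 * \<delta> i))" using assms by (intro prod.cong) auto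
  also have "\<dots> = ennreal (\<Prod>i<N. 2 * \<delta> i)" using assms by (intro prod_ennreal) auto
  finally show "emeasure (lebesgue_Rn N) ?X = ennreal (\<Prod>i<N. 2 * \<delta> i)" .
qed

lemma hom_norm_minus_commute: "hom_norm m n \<gamma> (z - w) = hom_norm m n \<gamma> (w - z)"
  by (simp add: hom_norm_def L2_set_def power2_commute)

lemma hom_norm_measurable:
  "(\<lambda>(z, w). hom_norm m n \<gamma> (z - w)) \<in> borel_measurable (lebesgue_Rn (m + n) \<Otimes>\<^sub>M lebesgue_Rn (m + n))"
proof -
  have c: "(\<lambda>z. z i) \<in> borel_measurable (lebesgue_Rn (m + n))" if "i < m + n" for i
    unfolding lebesgue_Rn_def using that
    by (intro measurable_completion measurable_compose[OF measurable_component_singleton]) auto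
  have coords: "(\<lambda>x. fst x i) \<in> borel_measurable (lebesgue_Rn (m + n) \<Otimes>\<^sub>M lebesgue_Rn (m + n))"
      "(\<lambda>x. snd x i) \<in> borel_measurable (lebesgue_Rn (m + n) \<Otimes>\<^sub>M lebesgue_Rn (m + n))" if "i < m + n" for i
    by (rule measurable_compose[OF measurable_fst c] measurable_compose[OF measurable_snd c], fact that)+
  have L2: "(\<lambda>x. L2_set (fst x - snd x) I)
      \<in> borel_measurable (lebesgue_Rn (m + n) \<Otimes>\<^sub>M lebesgue_Rn (m + n))" if "I \<subseteq> {..<m + n}" for I
    unfolding L2_set_def fun_diff_def using that
    by (intro measurable_compose[OF _ borel_measurable_sqrt] borel_measurable_sum borel_measurable_power borel_measurable_diff coords) auto
  show ?thesis
    unfolding hom_norm_def split_beta'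
    by (intro powr_real_measurable borel_measurable_add borel_measurable_power borel_measurable_const L2) auto
qed

text \<open>
  Balls of the homogeneous norm are contained in anisotropic boxes; the exponent \<open>1 + \<gamma>\<close> in the \<open>y\<close>
  coordinates is what makes the homogeneous dimension appear.
\<close>

lemma hom_norm_le_imp_coordinate_le:
  assumes g: "0 \<le> \<gamma>" and le: "hom_norm m n \<gamma> z \<le> \<rho>" and i: "i < m + n"
  shows "\<bar>z i\<bar> \<le> (if i < m then \<rho> else \<rho> powr (1 + \<gamma>))"
proof -
  let ?X = "L2_set z {..<m}" and ?Y = "L2_set z {m..<m + n}" and ?e = "2 * (\<gamma> + 1)"
  let ?S = "?X powr ?e + ?Y\<^sup>2"
  have S0: "0 \<le> ?S" by simp
  have \<rho>: "0 \<le> \<rho>" using le order_trans[of 0 "hom_norm m n \<gamma> z" \<rho>] by (simp add: hom_norm_def)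
  have "?S = (?S powr (1 / ?e)) powr ?e" using g S0 by (simp add: powr_powr)
  also have "\<dots> \<le> \<rho> powr ?e"
    using le g by (intro powr_mono2) (auto simp: hom_norm_def)
  finally have S: "?S \<le> \<rho> powr ?e" .
  show ?thesis
  proof (cases "i < m")
    case True
    have "?X powr ?e \<le> \<rho> powr ?e" using S by (smt (verit) zero_le_power2)
    moreover have "\<rho> powr ?e < ?X powr ?e" if "\<rho> < ?X" using that g \<rho> by (intro powr_less_mono2) auto
    ultimately have "?X \<le> \<rho>" by (meson not_le)
    moreover have "\<bar>z i\<bar> \<le> ?X" using member_le_L2_set[of "{..<m}" i "\<lambda>i. \<bar>z i\<bar>"] True by (simp add: L2_set_def)
    ultimately show ?thesis using True by simp
  next
    case False
    have "?Y\<^sup>2 \<le> \<rho> powr ?e" using S by (smt (verit) powr_ge_zero)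
    also have "\<dots> = (\<rho> powr (1 + \<gamma>))\<^sup>2"
      by (simp add: power2_eq_square add_ac flip: powr_add)
    finally have "?Y \<le> \<rho> powr (1 + \<gamma>)" by (simp add: power2_le_iff_abs_le L2_set_nonneg)
    moreover have "\<bar>z i\<bar> \<le> ?Y"
      using member_le_L2_set[of "{m..<m + n}" i "\<lambda>i. \<bar>z i\<bar>"] False i by (simp add: L2_set_def)
    ultimately show ?thesis using False by simp
  qed
qed

text \<open>
  The superlevel set at height \<open>t\<close> is the closed ball of radius \<open>\<rho> = t powr (- 1 / Q)\<close> around \<open>w\<close> without its
  centre, where \<open>0 powr (- Q) = 0\<close>. Its bounding box has volume \<open>2 ^ (m + n) * \<rho> powr Q\<close>; the power of
  two is enlarged to \<open>2 powr Q\<close> to remove the dependence on \<open>m\<close> and \<open>n\<close>.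
\<close>

lemma hom_norm_kernel_weak_L1:
  assumes mn: "0 < m + n" and g: "0 \<le> \<gamma>" and t: "0 < t"
  defines "Q \<equiv> hom_dim m n \<gamma>"
  shows "emeasure (lebesgue_Rn (m + n)) {z \<in> space (lebesgue_Rn (m + n)). t \<le> hom_norm m n \<gamma> (z - w) powr (- Q)}
    \<le> ennreal (2 powr Q / t)"
proof -
  have "real m + 1 * real n \<le> Q" unfolding Q_def hom_dim_def
    using g by (intro add_left_mono mult_right_mono) auto
  then have NQ: "real (m + n) \<le> Q" by simp
  then have Q: "0 < Q" using mn by linarith
  define \<rho> where "\<rho> = t powr (- 1 / Q)"
  define \<delta> where "\<delta> i = (if i < m then \<rho> else \<rho> powr (1 + \<gamma>))" for i
  have \<rho>: "0 < \<rho>" using t by (simp add: \<rho>_def)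
  then have \<delta>: "0 \<le> \<delta> i" for i by (simp add: \<delta>_def)
  have "{z \<in> space (lebesgue_Rn (m + n)). t \<le> hom_norm m n \<gamma> (z - w) powr (- Q)}
      \<subseteq> (\<Pi>\<^sub>E i\<in>{..<m + n}. {w i - \<delta> i..w i + \<delta> i})"
  proof (rule subsetI)
    fix z assume "z \<in> {z \<in> space (lebesgue_Rn (m + n)). t \<le> hom_norm m n \<gamma> (z - w) powr (- Q)}"
    then have z: "z \<in> space (lebesgue_Rn (m + n))" "t \<le> hom_norm m n \<gamma> (z - w) powr (- Q)" by auto
    let ?d = "hom_norm m n \<gamma> (z - w)"
    have d: "0 < ?d" using z(2) t by (cases "?d = 0") (auto simp: hom_norm_def)
    have "?d = (?d powr (- Q)) powr (- 1 / Q)" using d Q by (simp add: powr_powr)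
    also have "\<dots> \<le> \<rho>" unfolding \<rho>_def using z(2) t Q by (intro powr_mono2') auto
    finally have "\<bar>z i - w i\<bar> \<le> \<delta> i" if "i < m + n" for i
      using hom_norm_le_imp_coordinate_le[OF g _ that, of "z - w" \<rho>] by (simp add: \<delta>_def)
    then have "z i \<in> {w i - \<delta> i..w i + \<delta> i}" if "i < m + n" for i
      using that by (simp add: abs_diff_le_iff algebra_simps)
    then show "z \<in> (\<Pi>\<^sub>E i\<in>{..<m + n}. {w i - \<delta> i..w i + \<delta> i})"
      using z(1) unfolding space_lebesgue_Rn PiE_iff by blast
  qed
  then have "emeasure (lebesgue_Rn (m + n)) {z \<in> space (lebesgue_Rn (m + n)). t \<le> hom_norm m n \<gamma> (z - w) powr (- Q)}
      \<le> emeasure (lebesgue_Rn (m + n)) (\<Pi>\<^sub>E i\<in>{..<m + n}. {w i - \<delta> i..w i + \<delta> i})"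
    using \<delta> by (intro emeasure_mono emeasure_lebesgue_Rn_box(1)) auto
  also have "\<dots> = ennreal (\<Prod>i<m + n. 2 * \<delta> i)" using \<delta> by (intro emeasure_lebesgue_Rn_box(2))
  also have "(\<Prod>i<m + n. 2 * \<delta> i) \<le> 2 powr Q / t"
  proof -
    have split: "{..<m + n} = {..<m} \<union> {m..<m + n}" by auto
    have "(\<Prod>i<m + n. \<delta> i) = (\<Prod>i<m. \<delta> i) * (\<Prod>i=m..<m + n. \<delta> i)"
      unfolding split by (intro prod.union_disjoint) auto
    also have "\<dots> = \<rho> ^ m * (\<rho> powr (1 + \<gamma>)) ^ n" by (simp add: \<delta>_def)
    also have "\<dots> = \<rho> powr real m * \<rho> powr ((1 + \<gamma>) * real n)"
      using \<rho> by (simp only: powr_realpow powr_powr[symmetric] powr_gt_zero)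
    also have "\<dots> = \<rho> powr Q" by (simp only: Q_def hom_dim_def powr_add)
    also have "\<dots> = t powr (- 1)" using Q by (simp add: \<rho>_def powr_powr)
    also have "\<dots> = 1 / t" using t by (simp add: powr_minus_divide)
    finally have "(\<Prod>i<m + n. 2 * \<delta> i) = 2 ^ (m + n) / t" by (simp add: prod.distrib)
    also have "\<dots> \<le> 2 powr Q / t"
      using NQ t by (intro divide_right_mono) (auto simp flip: powr_realpow)
    finally show ?thesis .
  qed
  finally show ?thesis by (simp add: ennreal_leI)
qed

section \<open>The inequality for the homogeneous norm\<close>

theorem proposition2p2:
  "\<exists>C :: real \<Rightarrow> real \<Rightarrow> real \<Rightarrow> real \<Rightarrow> real.
     \<forall>(m :: nat) (n :: nat) (\<gamma> :: real) (p :: real) (r :: real) (\<mu> :: real).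
       m + n \<ge> 3 \<longrightarrow> \<gamma> \<ge> 0 \<longrightarrow> p > 1 \<longrightarrow> r > 1 \<longrightarrow> 0 < \<mu> \<longrightarrow> \<mu> < hom_dim m n \<gamma> \<longrightarrow>
       1 / p + \<mu> / hom_dim m n \<gamma> + 1 / r = 2 \<longrightarrow>
         C p (hom_dim m n \<gamma>) \<mu> r > 0 \<and>
         (\<forall>f \<in> Lp_space p (lebesgue_Rn (m + n)). \<forall>h \<in> Lp_space r (lebesgue_Rn (m + n)).
            integrable (lebesgue_Rn (m + n) \<Otimes>\<^sub>M lebesgue_Rn (m + n))
              (\<lambda>(z, w). HLS_integrand m n \<gamma> \<mu> f h z w) \<and>
            (LINT w|lebesgue_Rn (m + n). LINT z|lebesgue_Rn (m + n). HLS_integrand m n \<gamma> \<mu> f h z w)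
              \<le> C p (hom_dim m n \<gamma>) \<mu> r * Lp_norm p (lebesgue_Rn (m + n)) f
                                       * Lp_norm r (lebesgue_Rn (m + n)) h)"
proof (intro exI allI impI)
  fix m n :: nat and \<gamma> p r \<mu> :: real
  define Q where "Q = hom_dim m n \<gamma>"
  let ?C = "\<lambda>p Q \<mu> r. slice_const (2 powr Q) (1 / p) (\<mu> / Q) + slice_const (2 powr Q) (1 / r) (\<mu> / Q)"
  let ?L = "lebesgue_Rn (m + n)"
  define K where "K = (\<lambda>(z, w). hom_norm m n \<gamma> (z - w) powr (- Q))"
  assume mn: "m + n \<ge> 3" and g: "\<gamma> \<ge> 0" and p: "p > 1" and r: "r > 1" and \<mu>: "0 < \<mu>" "\<mu> < hom_dim m n \<gamma>"
    and eq: "1 / p + \<mu> / hom_dim m n \<gamma> + 1 / r = 2"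
  have c: "0 < \<mu> / Q" "\<mu> / Q < 1" "1 / p + \<mu> / Q + 1 / r = 2" using \<mu> eq by (auto simp: Q_def)
  have K: "K \<in> borel_measurable (?L \<Otimes>\<^sub>M ?L)"
    unfolding K_def split_beta'
    by (intro powr_real_measurable hom_norm_measurable[unfolded split_beta'] borel_measurable_const)
  have mn0: "0 < m + n" using mn by linarith
  have weak1: "emeasure ?L {z \<in> space ?L. t \<le> K (z, w)} \<le> ennreal (2 powr Q / t)" if "0 < t" for w t
    using hom_norm_kernel_weak_L1[OF mn0 g that, of w] by (simp add: K_def Q_def)
  have weak2: "emeasure ?L {w \<in> space ?L. t \<le> K (z, w)} \<le> ennreal (2 powr Q / t)" if "0 < t" for z t
    using weak1[OF that, of z] by (simp add: K_def hom_norm_minus_commute[of m n \<gamma> z])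
  \<comment> \<open>The two conventions for the diagonal agree: both sides are \<open>0\<close> at \<open>z = w\<close>.\<close>
  have integrand: "HLS_integrand m n \<gamma> \<mu> f h z w = f z * h w * K (z, w) powr (\<mu> / Q)" for f h z w
  proof -
    have "K (z, w) powr (\<mu> / Q) = hom_norm m n \<gamma> (z - w) powr (- \<mu>)"
      using c(1) by (cases "Q = 0") (simp_all add: K_def powr_powr)
    then show ?thesis by (simp add: HLS_integrand_def powr_minus_divide)
  qed
  have HLS: "integrable (?L \<Otimes>\<^sub>M ?L) (\<lambda>(z, w). HLS_integrand m n \<gamma> \<mu> f h z w)"
      "(LINT w|?L. LINT z|?L. HLS_integrand m n \<gamma> \<mu> f h z w) \<le> ?C p Q \<mu> r * Lp_norm p ?L f * Lp_norm r ?L h"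
    if "f \<in> Lp_space p ?L" "h \<in> Lp_space r ?L" for f h
    unfolding integrand
    using weak_kernel_HLS[OF sigma_finite_lebesgue_Rn sigma_finite_lebesgue_Rn that K _ _ weak1 weak2 p r c]
    by (simp_all add: K_def split_beta')
  have "1 / p < 1" "1 / r < 1" using p r by auto
  then have "0 < ?C p Q \<mu> r"
    using slice_const_ge_1[of "2 powr Q" "\<mu> / Q" "1 / p"] slice_const_ge_1[of "2 powr Q" "\<mu> / Q" "1 / r"] c
    by simp
  then show "?C p (hom_dim m n \<gamma>) \<mu> r > 0 \<and>
      (\<forall>f \<in> Lp_space p ?L. \<forall>h \<in> Lp_space r ?L.
        integrable (?L \<Otimes>\<^sub>M ?L) (\<lambda>(z, w). HLS_integrand m n \<gamma> \<mu> f h z w) \<and>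
        (LINT w|?L. LINT z|?L. HLS_integrand m n \<gamma> \<mu> f h z w)
          \<le> ?C p (hom_dim m n \<gamma>) \<mu> r * Lp_norm p ?L f * Lp_norm r ?L h)"
    using HLS unfolding Q_def by blast
qed

end
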